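(* Let $X$ be a real normed space and $\mathcal{K}\subset X$ a pointed cone. The following are equivalent. (i) $0\in\mathrm{DP}(\mathcal{K})$. (ii) $0\in\mathrm{PC}(\mathcal{K})$ and $\widehat{\mathcal{K}}$ is pointed.
   Context: A cone $\mathcal{K}$ is a (nonempty) convex set with $\lambda k\in\mathcal{K}$ for all $\lambda\ge0$, $k\in\mathcal{K}$; it is pointed if $\mathcal{K}\cap(-\mathcal{K})=\{0\}$. $\widehat{\mathcal{K}}$, the completion of $\mathcal{K}$, is the norm closure of $i_X(\mathcal{K})$ in $X^{**}$, with $i_X:X\to X^{**}$ the canonical isometric inclusion (equivalently, the closure of $\mathcal{K}$ in the completion of $X$). $0\in\mathrm{DP}(\mathcal{K})$ (denting point) if for every norm neighbourhood $U$ of $0$, $0\notin\overline{\mathrm{conv}}(\mathcal{K}\setminus U)$. $0\in\mathrm{PC}(\mathcal{K})$ (point of continuity) if for every norm neighbourhood $U$ of $0$ there is a weak neighbourhood $W$ of $0$ with $W\cap\mathcal{K}\subset U$. *)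

theory Defs
  imports "HOL-Analysis.Analysis"
begin

definition pointed :: "'a::real_vector set \<Rightarrow> bool"
  where "pointed K \<longleftrightarrow> K \<inter> uminus ` K = {0}"

lift_definition bidual_embedding ::
  "'a::real_normed_vector \<Rightarrow> ('a \<Rightarrow>\<^sub>L real) \<Rightarrow>\<^sub>L real"
  is "\<lambda>x f. blinfun_apply f x"
  by (rule blinfun.bounded_linear_left)

(* The closure is taken in the operator-norm topology of the bidual. *)
definition cone_completion ::
  "'a::real_normed_vector set \<Rightarrow> (('a \<Rightarrow>\<^sub>L real) \<Rightarrow>\<^sub>L real) set"
  where "cone_completion K = closure (bidual_embedding ` K)"

definition weak_topology :: "'a::real_normed_vector topology"
  where "weak_topology =
    topology_generated_by {blinfun_apply f -` V |(f :: 'a \<Rightarrow>\<^sub>L real) V. open V}"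

(* Neighbourhoods need not be open. *)
definition neighbourhood_in :: "'a topology \<Rightarrow> 'a \<Rightarrow> 'a set \<Rightarrow> bool"
  where "neighbourhood_in T x U \<longleftrightarrow> (\<exists>V. openin T V \<and> x \<in> V \<and> V \<subseteq> U)"

definition denting_points :: "'a::real_normed_vector set \<Rightarrow> 'a set"
  where "denting_points S =
    {x \<in> S. \<forall>U. neighbourhood_in euclidean x U \<longrightarrow> x \<notin> closure (convex hull (S - U))}"

definition points_of_continuity :: "'a::real_normed_vector set \<Rightarrow> 'a set"
  where "points_of_continuity S =
    {x \<in> S. \<forall>U. neighbourhood_in euclidean x U \<longrightarrow>
      (\<exists>W. neighbourhood_in weak_topology x W \<and> W \<inter> S \<subseteq> U)}"

end

theory Submission
  imports Defs
begin

text \<open>If 0 is denting, Hahn--Banach separates it from the hull of the part of the cone outside the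
  unit ball by a functional \<open>f\<close>, and homogeneity gives \<open>f k \<ge> c * norm k\<close> on the cone; this inequality
  makes small slices small and passes to the completed cone, which is therefore pointed.
  Conversely, a weak neighbourhood witnessing continuity at 0 yields, again by homogeneity,
  finitely many functionals one of which is at least \<open>d * norm k\<close> at each \<open>k\<close> of the cone.
  By compactness in finite dimension, pointedness of the completed cone then makes the cone normal,
  \<open>norm u \<le> M * norm (u + v)\<close>, and normality keeps convex combinations of cone elements that are
  far from 0 far from 0.\<close>

section \<open>Sublinear functionals, Hahn--Banach, and separation of a convex set from a
  ball\<close>

definition sublinear :: "('a::real_vector \<Rightarrow> real) \<Rightarrow> bool"
  where "sublinear p \<longleftrightarrow>
    (\<forall>x y. p (x + y) \<le> p x + p y) \<and> (\<forall>x. \<forall>a>0. p (a *\<^sub>R x) = a * p x)"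

text \<open>One inequality of homogeneity suffices: applied with the factor \<open>1/a\<close> at
  the point \<open>a *\<^sub>R x\<close> it yields the reverse one.\<close>

lemma sublinearI:
  assumes "\<And>x y. p (x + y) \<le> p x + p y"
    and "\<And>x a. a > 0 \<Longrightarrow> p (a *\<^sub>R x) \<le> a * p x"
  shows "sublinear p"
  unfolding sublinear_def
proof (intro conjI allI impI)
  fix x and a :: real assume a: "a > 0"
  have "p ((1/a) *\<^sub>R (a *\<^sub>R x)) \<le> (1/a) * p (a *\<^sub>R x)"
    using assms(2)[of "1/a" "a *\<^sub>R x"] a by simp
  then have "a * p x \<le> p (a *\<^sub>R x)"
    using a by (simp add: field_simps)
  then show "p (a *\<^sub>R x) = a * p x"
    using assms(2)[OF a, of x] by simp
qed (rule assms(1))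

lemma sublinear_add: "sublinear p \<Longrightarrow> p (x + y) \<le> p x + p y"
  and sublinear_scale: "sublinear p \<Longrightarrow> a > 0 \<Longrightarrow> p (a *\<^sub>R x) = a * p x"
  unfolding sublinear_def by blast+

lemma sublinear_0: "sublinear p \<Longrightarrow> p 0 = 0"
  using sublinear_scale[of p 2 0] by simp

lemma sublinear_neg: "sublinear p \<Longrightarrow> - p (- x) \<le> p x"
  using sublinear_add[of p x "- x"] sublinear_0[of p] by simp

text \<open>Supplies the bounds for Zorn's lemma. Subadditivity requires estimating
  \<open>p x + q y\<close> for two different members \<open>p\<close> and \<open>q\<close>; in a
  chain the smaller of the two, evaluated at \<open>x + y\<close>, does this.\<close>

lemma sublinear_INF_chain:
  fixes C :: "('a::real_vector \<Rightarrow> real) set"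
  assumes "C \<noteq> {}"
    and sub: "\<And>p. p \<in> C \<Longrightarrow> sublinear p"
    and bdd: "\<And>x. bdd_below ((\<lambda>p. p x) ` C)"
    and chain: "\<And>p q. p \<in> C \<Longrightarrow> q \<in> C \<Longrightarrow> p \<le> q \<or> q \<le> p"
  shows "sublinear (\<lambda>x. INF p\<in>C. p x)"
proof (rule sublinearI)
  fix x y
  have *: "(INF p\<in>C. p (x + y)) \<le> p x + q y" if pq: "p \<in> C" "q \<in> C" for p q
  proof -
    obtain r where r: "r \<in> C" "r \<le> p" "r \<le> q"
      using chain[OF pq] pq by blast
    have "(INF p\<in>C. p (x + y)) \<le> r (x + y)"
      using r(1) bdd by (intro cINF_lower)
    also have "\<dots> \<le> r x + r y"
      using sublinear_add sub r(1) by blast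
    also have "\<dots> \<le> p x + q y"
      using r by (simp add: le_fun_def add_mono)
    finally show ?thesis .
  qed
  have "(INF p\<in>C. p (x + y)) - q y \<le> (INF p\<in>C. p x)" if "q \<in> C" for q
    using *[OF _ that] \<open>C \<noteq> {}\<close> by (intro cINF_greatest) (auto simp: algebra_simps)
  then have "(INF p\<in>C. p (x + y)) - (INF p\<in>C. p x) \<le> (INF p\<in>C. p y)"
    using \<open>C \<noteq> {}\<close> by (intro cINF_greatest) (auto simp: algebra_simps)
  then show "(INF p\<in>C. p (x + y)) \<le> (INF p\<in>C. p x) + (INF p\<in>C. p y)"
    by simp
next
  fix x and a :: real assume a: "a > 0"
  have "(INF p\<in>C. p (a *\<^sub>R x)) / a \<le> p x" if "p \<in> C" for p
  proof -
    have "(INF p\<in>C. p (a *\<^sub>R x)) \<le> p (a *\<^sub>R x)"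
      using that bdd by (intro cINF_lower)
    also have "\<dots> = a * p x"
      using sublinear_scale[OF sub[OF that] a] .
    finally show ?thesis using a by (simp add: field_simps)
  qed
  then have "(INF p\<in>C. p (a *\<^sub>R x)) / a \<le> (INF p\<in>C. p x)"
    using \<open>C \<noteq> {}\<close> by (intro cINF_greatest)
  then show "(INF p\<in>C. p (a *\<^sub>R x)) \<le> a * (INF p\<in>C. p x)"
    using a by (simp add: field_simps)
qed

text \<open>The infimum over \<open>t\<close> of \<open>p (x + t *\<^sub>R y) - t * p y\<close> is again sublinear and below \<open>p\<close>, so minimality
  makes it equal to \<open>p\<close>; taking \<open>t = 1\<close> gives superadditivity.\<close>

lemma minimal_sublinear_additive:
  assumes p: "sublinear p"
    and min: "\<And>q. sublinear q \<Longrightarrow> q \<le> p \<Longrightarrow> q = p"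
  shows "p (x + y) = p x + p y"
proof -
  define q where "q = (\<lambda>x. INF t\<in>{0..}. p (x + t *\<^sub>R y) - t * p y)"
  have tp: "p (t *\<^sub>R y) = t * p y" if "t \<ge> 0" for t
    using that sublinear_scale[OF p] sublinear_0[OF p] by (cases "t = 0") auto
  have "- p (- x) \<le> p (x + t *\<^sub>R y) - t * p y" if "t \<ge> 0" for x t
    using sublinear_add[OF p, of "x + t *\<^sub>R y" "- x"] tp[OF that] by simp
  then have "bdd_below ((\<lambda>t. p (x + t *\<^sub>R y) - t * p y) ` {0..})" for x
    by (intro bdd_belowI2[of _ "- p (- x)"]) auto
  then have q_le: "q x \<le> p (x + t *\<^sub>R y) - t * p y" if "t \<ge> 0" for x t
    unfolding q_def using that by (intro cINF_lower) auto
  have q_ge: "c \<le> q x" if "\<And>t. t \<ge> 0 \<Longrightarrow> c \<le> p (x + t *\<^sub>R y) - t * p y" for c x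
    unfolding q_def using that by (intro cINF_greatest) auto
  have "sublinear q"
  proof (rule sublinearI)
    fix u v
    have *: "q (u + v) \<le> (p (u + s *\<^sub>R y) - s * p y) + (p (v + t *\<^sub>R y) - t * p y)"
      if "s \<ge> 0" "t \<ge> 0" for s t
    proof -
      have "q (u + v) \<le> p (u + v + (s + t) *\<^sub>R y) - (s + t) * p y"
        using that by (intro q_le) simp
      moreover have "u + v + (s + t) *\<^sub>R y = (u + s *\<^sub>R y) + (v + t *\<^sub>R y)"
        by (simp add: algebra_simps)
      ultimately show ?thesis
        using sublinear_add[OF p, of "u + s *\<^sub>R y" "v + t *\<^sub>R y"] by (simp add: algebra_simps)
    qed
    have "q (u + v) - (p (v + t *\<^sub>R y) - t * p y) \<le> q u" if "t \<ge> 0" for t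
      using *[OF _ that] by (intro q_ge) (simp add: algebra_simps)
    then have "q (u + v) - q u \<le> q v"
      by (intro q_ge) (simp add: algebra_simps)
    then show "q (u + v) \<le> q u + q v" by simp
  next
    fix u and a :: real assume a: "a > 0"
    have "q (a *\<^sub>R u) / a \<le> q u"
    proof (rule q_ge)
      fix t :: real assume "t \<ge> 0"
      then have "q (a *\<^sub>R u) \<le> p (a *\<^sub>R u + (a * t) *\<^sub>R y) - (a * t) * p y"
        using a by (intro q_le) simp
      also have "p (a *\<^sub>R u + (a * t) *\<^sub>R y) = a * p (u + t *\<^sub>R y)"
        using sublinear_scale[OF p a, of "u + t *\<^sub>R y"] by (simp add: scaleR_add_right)
      finally show "q (a *\<^sub>R u) / a \<le> p (u + t *\<^sub>R y) - t * p y"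
        using a by (simp add: field_simps)
    qed
    then show "q (a *\<^sub>R u) \<le> a * q u"
      using a by (simp add: field_simps)
  qed
  moreover have "q \<le> p"
    using q_le[of 0] by (simp add: le_fun_def)
  ultimately have "q = p" by (rule min)
  then have "p x \<le> p (x + y) - p y"
    using q_le[of 1 x] by simp
  then show ?thesis
    using sublinear_add[OF p, of x y] by simp
qed

text \<open>Zorn's lemma gives a minimal sublinear functional below \<open>q\<close>. Minimality
  makes it additive, hence odd, and positive homogeneity then extends to all real factors.\<close>

theorem Hahn_Banach_sublinear:
  fixes q :: "'a::real_vector \<Rightarrow> real"
  assumes q: "sublinear q"
  obtains f where "linear f" "f \<le> q"
proof -
  define A where "A = {p. sublinear p \<and> p \<le> q}"
  \<comment> \<open>The order is reversed because \<open>predicate_Zorn\<close> produces maximal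
    elements.\<close>
  let ?P = "\<lambda>p r :: 'a \<Rightarrow> real. r \<le> p"
  have "\<exists>m\<in>A. \<forall>a\<in>A. ?P m a \<longrightarrow> a = m"
  proof (rule predicate_Zorn)
    show "partial_order_on A (relation_of ?P A)"
      by (rule partial_order_on_relation_ofI) auto
  next
    fix C assume "C \<in> Chains (relation_of ?P A)"
    then have CA: "C \<subseteq> A" and chain: "\<And>p r. p \<in> C \<Longrightarrow> r \<in> C \<Longrightarrow> p \<le> r \<or> r \<le> p"
      by (auto simp: Chains_def relation_of_def)
    show "\<exists>u\<in>A. \<forall>a\<in>C. ?P a u"
    proof (cases "C = {}")
      case True
      then show ?thesis using q by (auto simp: A_def)
    next
      case False
      let ?u = "\<lambda>x. INF p\<in>C. p x"
      have bdd: "bdd_below ((\<lambda>p. p x) ` C)" for x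
      proof (rule bdd_belowI2)
        fix p assume "p \<in> C"
        then have "sublinear p" "p (- x) \<le> q (- x)"
          using CA by (auto simp: A_def le_fun_def)
        then show "- q (- x) \<le> p x"
          using sublinear_neg[of p x] by simp
      qed
      have "sublinear ?u"
        using False CA bdd chain by (intro sublinear_INF_chain) (auto simp: A_def)
      moreover have le: "?u \<le> p" if "p \<in> C" for p
        using that bdd by (auto simp: le_fun_def intro: cINF_lower)
      moreover have "?u \<le> q"
      proof -
        obtain p where "p \<in> C" using False by blast
        then show ?thesis using le[of p] CA by (auto simp: A_def intro: order_trans)
      qed
      ultimately show ?thesis by (auto simp: A_def)
    qed
  qed
  then obtain f where f: "sublinear f" "f \<le> q"
    and min: "\<And>p. sublinear p \<Longrightarrow> p \<le> f \<Longrightarrow> p = f"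
    unfolding A_def by (blast intro: order_trans)
  have add: "f (x + y) = f x + f y" for x y
    using minimal_sublinear_additive[OF f(1) min] .
  have neg: "f (- x) = - f x" for x
    using add[of x "- x"] sublinear_0[OF f(1)] by simp
  have "f (a *\<^sub>R x) = a *\<^sub>R f x" for a x
  proof (cases a "0 :: real" rule: linorder_cases)
    case less
    then show ?thesis
      using sublinear_scale[OF f(1), of "- a" x] neg[of "a *\<^sub>R x"] by simp
  qed (use sublinear_scale[OF f(1)] sublinear_0[OF f(1)] in auto)
  then have "linear f" by (intro linearI add)
  then show ?thesis using that f(2) by blast
qed

text \<open>Hahn--Banach is applied to the infimum \<open>q x\<close> of
  \<open>norm (x + t *\<^sub>R y) - r * t\<close> over t \<ge> 0 and \<open>y\<close> in
  \<open>C\<close>. A linear \<open>f\<close> below \<open>q\<close> is bounded by the norm (take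
  \<open>t = 0\<close>) and satisfies f (- y) \<le> - r (take \<open>t = 1\<close> at the point
  \<open>- y\<close>).\<close>

lemma separate_convex_from_ball:
  fixes C :: "'a::real_normed_vector set"
  assumes "convex C" and far: "\<And>y. y \<in> C \<Longrightarrow> r \<le> norm y"
  obtains f :: "'a \<Rightarrow>\<^sub>L real" where "\<And>y. y \<in> C \<Longrightarrow> r \<le> blinfun_apply f y"
proof (cases "C = {}")
  case True
  then show ?thesis using that by blast
next
  case False
  \<comment> \<open>This is the cone over \<open>{1} \<times> C\<close>. It is closed under sums
    because \<open>C\<close> is convex, which makes \<open>q\<close> subadditive, and under positive
    multiples, which makes \<open>q\<close> homogeneous.\<close>
  define Z where "Z = {(t, t *\<^sub>R y) |t y. t \<ge> 0 \<and> y \<in> C}"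
  define q where "q = (\<lambda>x. INF z\<in>Z. norm (x + snd z) - r * fst z)"
  have Z0: "(0, 0) \<in> Z"
    using False by (force simp: Z_def)
  have Z_add: "(s + t, y + z) \<in> Z" if st: "(s, y) \<in> Z" "(t, z) \<in> Z" for s t y z
  proof -
    obtain y' z' where y': "s \<ge> 0" "y = s *\<^sub>R y'" "y' \<in> C" and z': "t \<ge> 0" "z = t *\<^sub>R z'" "z' \<in> C"
      using st by (auto simp: Z_def)
    show ?thesis
    proof (cases "s + t = 0")
      case True
      then have "s = 0" "t = 0" using y'(1) z'(1) by auto
      then show ?thesis using y' z' Z0 by simp
    next
      case nz: False
      let ?w = "(s / (s + t)) *\<^sub>R y' + (t / (s + t)) *\<^sub>R z'"
      have "?w \<in> C"
        using \<open>convex C\<close> y' z' nz by (intro convexD) (auto simp flip: add_divide_distrib)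
      moreover have "y + z = (s + t) *\<^sub>R ?w"
        using nz y'(2) z'(2) by (simp add: scaleR_add_right)
      moreover have "s + t \<ge> 0" using y'(1) z'(1) by simp
      ultimately show ?thesis unfolding Z_def by (intro CollectI exI[of _ "s + t"] exI[of _ ?w]) simp
    qed
  qed
  have Z_scale: "(a * t, a *\<^sub>R y) \<in> Z" if ty: "(t, y) \<in> Z" and "a > 0" for a t y
  proof -
    obtain y' where "t \<ge> 0" "y = t *\<^sub>R y'" "y' \<in> C"
      using ty by (auto simp: Z_def)
    then show ?thesis
      unfolding Z_def using \<open>a > 0\<close> by (auto intro!: exI[of _ y'])
  qed
  \<comment> \<open>The infimum defining \<open>q x\<close> is finite because
    \<open>t *\<^sub>R y\<close> has norm at least \<open>r * t\<close>.\<close>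
  have "- norm x \<le> norm (x + snd z) - r * fst z" if z: "z \<in> Z" for x z
  proof -
    obtain t y where ty: "z = (t, t *\<^sub>R y)" "t \<ge> 0" "y \<in> C"
      using z by (auto simp: Z_def)
    have "r * t \<le> norm (t *\<^sub>R y)"
      using mult_right_mono[OF far[OF ty(3)] ty(2)] ty(2) by (simp add: mult.commute)
    also have "\<dots> \<le> norm (x + t *\<^sub>R y) + norm x"
      using norm_triangle_ineq4[of "x + t *\<^sub>R y" x] by simp
    finally show ?thesis using ty by simp
  qed
  then have "bdd_below ((\<lambda>z. norm (x + snd z) - r * fst z) ` Z)" for x
    by (intro bdd_belowI2[of _ "- norm x"]) auto
  then have q_le: "q x \<le> norm (x + y) - r * t" if "(t, y) \<in> Z" for x t y
    unfolding q_def using that cINF_lower[of "\<lambda>z. norm (x + snd z) - r * fst z" Z "(t, y)"] by simp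
  have q_ge: "c \<le> q x" if "\<And>t y. (t, y) \<in> Z \<Longrightarrow> c \<le> norm (x + y) - r * t" for c x
    unfolding q_def using that Z0 by (intro cINF_greatest) auto
  have "sublinear q"
  proof (rule sublinearI)
    fix u v
    have *: "q (u + v) \<le> (norm (u + y) - r * s) + (norm (v + z) - r * t)"
      if "(s, y) \<in> Z" "(t, z) \<in> Z" for s t y z
    proof -
      have "q (u + v) \<le> norm (u + v + (y + z)) - r * (s + t)"
        using q_le[OF Z_add[OF that]] .
      moreover have "u + v + (y + z) = (u + y) + (v + z)" by simp
      ultimately show ?thesis
        using norm_triangle_ineq[of "u + y" "v + z"] by (simp add: algebra_simps)
    qed
    have "q (u + v) - (norm (v + z) - r * t) \<le> q u" if "(t, z) \<in> Z" for t z
      using *[OF _ that] by (intro q_ge) (simp add: algebra_simps)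
    then have "q (u + v) - q u \<le> q v"
      by (intro q_ge) (simp add: algebra_simps)
    then show "q (u + v) \<le> q u + q v" by simp
  next
    fix u and a :: real assume a: "a > 0"
    have "q (a *\<^sub>R u) / a \<le> q u"
    proof (rule q_ge)
      fix t y assume "(t, y) \<in> Z"
      then have "q (a *\<^sub>R u) \<le> norm (a *\<^sub>R u + a *\<^sub>R y) - r * (a * t)"
        using a by (intro q_le Z_scale)
      also have "norm (a *\<^sub>R u + a *\<^sub>R y) = a * norm (u + y)"
        using a by (simp flip: scaleR_add_right)
      finally show "q (a *\<^sub>R u) / a \<le> norm (u + y) - r * t"
        using a by (simp add: field_simps)
    qed
    then show "q (a *\<^sub>R u) \<le> a * q u"
      using a by (simp add: field_simps)
  qed
  then obtain f where f: "linear f" "f \<le> q"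
    by (rule Hahn_Banach_sublinear)
  have f_le: "f x \<le> norm x" for x
    using le_funD[OF f(2), of x] q_le[OF Z0, of x] by simp
  have "bounded_linear f"
  proof (rule bounded_linear_intro[where K = 1])
    show "norm (f x) \<le> norm x * 1" for x
      using f_le[of x] f_le[of "- x"] linear_neg[OF f(1), of x] by simp
  qed (use f(1) in \<open>simp_all add: linear_add linear_scale\<close>)
  moreover have "r \<le> f y" if "y \<in> C" for y
  proof -
    have "(1, y) \<in> Z" using that unfolding Z_def by (auto intro!: exI[of _ y])
    then have "q (- y) \<le> - r" using q_le[of 1 y "- y"] by simp
    then show ?thesis
      using le_funD[OF f(2), of "- y"] linear_neg[OF f(1), of y] by simp
  qed
  ultimately show ?thesis
    using that[of "Blinfun f"] by (simp add: bounded_linear_Blinfun_apply)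
qed

section \<open>The bidual embedding, neighbourhoods of 0, and subsequences\<close>

lemma linear_bidual_embedding: "linear bidual_embedding"
  by (intro linearI; transfer) (auto simp: blinfun.bilinear_simps)

lemma norm_bidual_embedding_le: "norm (bidual_embedding x) \<le> norm x"
proof (rule norm_blinfun_bound)
  show "norm (blinfun_apply (bidual_embedding x) f) \<le> norm x * norm f" for f
    using norm_blinfun[of f x] by (simp add: bidual_embedding.rep_eq mult.commute)
qed simp

text \<open>Carries Cauchy estimates from the possibly incomplete space to its bidual, where limits
  exist.\<close>

lemma dist_bidual_embedding_le: "dist (bidual_embedding x) (bidual_embedding y) \<le> dist x y"
  using norm_bidual_embedding_le[of "x - y"]
  by (simp add: dist_norm linear_diff[OF linear_bidual_embedding])

lemma neighbourhood_in_euclidean_0: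
  fixes U :: "'a::real_normed_vector set"
  shows "neighbourhood_in euclidean 0 U \<longleftrightarrow> (\<exists>e>0. ball 0 e \<subseteq> U)"
proof
  assume "neighbourhood_in euclidean 0 U"
  then obtain V where "open V" "0 \<in> V" "V \<subseteq> U"
    by (auto simp: neighbourhood_in_def)
  then show "\<exists>e>0. ball 0 e \<subseteq> U"
    unfolding open_contains_ball by (blast intro: order_trans)
next
  assume "\<exists>e>0. ball 0 e \<subseteq> U"
  then show "neighbourhood_in euclidean 0 U"
    unfolding neighbourhood_in_def by (metis centre_in_ball open_ball open_openin)
qed

text \<open>Induction on the generation of the topology: an intersection takes the union of the two
  families and the smaller width, and a subbasic set containing 0 contains a slab of its single
  functional.\<close>

lemma weak_open_contains_slab:
  fixes V :: "'a::real_normed_vector set"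
  assumes "openin weak_topology V" "0 \<in> V"
  obtains G :: "('a \<Rightarrow>\<^sub>L real) set" and d :: real
  where "finite G" "d > 0" "{x. \<forall>g\<in>G. \<bar>blinfun_apply g x\<bar> < d} \<subseteq> V"
proof -
  have "generate_topology_on {blinfun_apply f -` V |(f :: 'a \<Rightarrow>\<^sub>L real) V. open V} V"
    using assms(1) by (simp add: weak_topology_def openin_topology_generated_by_iff)
  then have "\<exists>(G :: ('a \<Rightarrow>\<^sub>L real) set) d. finite G \<and> d > 0 \<and>
    {x. \<forall>g\<in>G. \<bar>blinfun_apply g x\<bar> < d} \<subseteq> V"
    using \<open>0 \<in> V\<close>
  proof induction
    case Empty
    then show ?case by simp
  next
    case (Int a b)
    then obtain G H :: "('a \<Rightarrow>\<^sub>L real) set" and d e :: real where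
      "finite G" "d > 0" "{x. \<forall>g\<in>G. \<bar>blinfun_apply g x\<bar> < d} \<subseteq> a"
      "finite H" "e > 0" "{x. \<forall>g\<in>H. \<bar>blinfun_apply g x\<bar> < e} \<subseteq> b"
      by auto
    then show ?case
      by (intro exI[of _ "G \<union> H"] exI[of _ "min d e"]) auto
  next
    case (UN k)
    then obtain a where a: "a \<in> k" "0 \<in> a" by blast
    then show ?case using UN.IH[OF a] by blast
  next
    case (Basis s)
    then obtain f :: "'a \<Rightarrow>\<^sub>L real" and O' where s: "s = blinfun_apply f -` O'" "open O'" by blast
    then have "0 \<in> O'" using Basis(2) by (simp add: blinfun.zero_right)
    then obtain d where d: "d > 0" "ball 0 d \<subseteq> O'"
      using s(2) open_contains_ball by blast
    then show ?case
      using s(1) by (intro exI[of _ "{f}"] exI[of _ d]) (auto simp: subset_iff)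
  qed
  then show ?thesis using that by blast
qed

text \<open>Bolzano--Weierstrass is applied once per function; convergence already obtained survives
  each further subsequence.\<close>

lemma convergent_subseq_finite_family:
  fixes u :: "nat \<Rightarrow> 'a" and G :: "('a \<Rightarrow> real) set"
  assumes "finite G" and "\<And>g. g \<in> G \<Longrightarrow> bounded (range (\<lambda>n. g (u n)))"
  obtains r :: "nat \<Rightarrow> nat" where "strict_mono r" "\<And>g. g \<in> G \<Longrightarrow> convergent (\<lambda>n. g (u (r n)))"
proof -
  have "\<exists>r :: nat \<Rightarrow> nat. strict_mono r \<and> (\<forall>g\<in>G. convergent (\<lambda>n. g (u (r n))))"
    using assms
  proof induction
    case empty
    then show ?case using strict_mono_id by auto
  next
    case (insert h G)
    then obtain r :: "nat \<Rightarrow> nat" where r: "strict_mono r" "\<And>g. g \<in> G \<Longrightarrow> convergent (\<lambda>n. g (u (r n)))"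
      by auto
    have "bounded (range (\<lambda>n. h (u (r n))))"
      by (rule bounded_subset[OF insert.prems[of h]]) auto
    then obtain l s where s: "strict_mono (s :: nat \<Rightarrow> nat)" "((\<lambda>n. h (u (r n))) \<circ> s) \<longlonglongrightarrow> l"
      using bounded_imp_convergent_subsequence by blast
    have "convergent (\<lambda>n. g (u ((r \<circ> s) n)))" if "g \<in> insert h G" for g
    proof (cases "g = h")
      case True
      then show ?thesis using s(2) by (auto simp: convergent_def o_def)
    next
      case False
      then have "convergent ((\<lambda>n. g (u (r n))) \<circ> s)"
        using r(2) that s(1) by (intro convergent_subseq_convergent) auto
      then show ?thesis by (simp add: o_def)
    qed
    then show ?case using strict_mono_o[OF r(1) s(1)] by blast
  qed
  then show ?thesis using that by blast
qed

section \<open>Denting implies continuity and a pointed completion\<close>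

lemma convex_coneD:
  assumes "convex_cone K"
  shows "0 \<in> K" "\<And>x y. x \<in> K \<Longrightarrow> y \<in> K \<Longrightarrow> x + y \<in> K"
    "\<And>a x. x \<in> K \<Longrightarrow> a \<ge> 0 \<Longrightarrow> a *\<^sub>R x \<in> K"
  using assms convex_cone_contains_0 convex_cone_add convex_cone_scaleR by auto

lemma denting_imp_norming_functional:
  fixes K :: "'a::real_normed_vector set"
  assumes K: "convex_cone K" and dent: "0 \<in> denting_points K"
  obtains f :: "'a \<Rightarrow>\<^sub>L real" and c :: real
  where "c > 0" "\<And>k. k \<in> K \<Longrightarrow> c * norm k \<le> blinfun_apply f k"
proof -
  let ?C = "convex hull (K - ball 0 1)"
  have "neighbourhood_in euclidean 0 (ball (0::'a) 1)"
    by (auto simp: neighbourhood_in_euclidean_0 intro: exI[of _ 1])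
  then have "0 \<notin> closure ?C"
    using dent by (simp add: denting_points_def)
  then obtain c where c: "c > 0" "\<And>y. y \<in> ?C \<Longrightarrow> c \<le> norm y"
    unfolding closure_approachable by (auto simp: not_less)
  obtain f :: "'a \<Rightarrow>\<^sub>L real" where f: "\<And>y. y \<in> ?C \<Longrightarrow> c \<le> blinfun_apply f y"
    using separate_convex_from_ball[of ?C c] c(2) by auto
  have "c * norm k \<le> blinfun_apply f k" if "k \<in> K" for k
  proof (cases "k = 0")
    case False
    \<comment> \<open>The ball removed is open, so unit vectors of the cone remain; the bound
      \<open>c\<close> on them scales to \<open>c * norm k\<close>.\<close>
    have "(1 / norm k) *\<^sub>R k \<in> K - ball 0 1"
      using convex_coneD(3)[OF K that, of "1 / norm k"] False by simp
    then have "c \<le> blinfun_apply f ((1 / norm k) *\<^sub>R k)"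
      by (intro f hull_inc)
    then show ?thesis
      using False by (simp add: blinfun.scaleR_right field_simps)
  qed (simp add: blinfun.zero_right)
  then show ?thesis using that c(1) by blast
qed

lemma norming_functional_imp_point_of_continuity:
  fixes f :: "'a::real_normed_vector \<Rightarrow>\<^sub>L real"
  assumes "0 \<in> K" "c > 0" and f: "\<And>k. k \<in> K \<Longrightarrow> c * norm k \<le> blinfun_apply f k"
  shows "0 \<in> points_of_continuity K"
  unfolding points_of_continuity_def
proof (intro CollectI conjI allI impI)
  fix U :: "'a set" assume "neighbourhood_in euclidean 0 U"
  then obtain e where e: "e > 0" "ball 0 e \<subseteq> U"
    by (auto simp: neighbourhood_in_euclidean_0)
  \<comment> \<open>The width \<open>c * e\<close> is chosen so that membership of \<open>k\<close>
    in the slice forces \<open>norm k < e\<close> on the cone.\<close>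
  let ?W = "blinfun_apply f -` {..<c * e}"
  have "openin weak_topology ?W"
    unfolding weak_topology_def by (rule topology_generated_by_Basis) (use open_lessThan in blast)
  then have "neighbourhood_in weak_topology 0 ?W"
    unfolding neighbourhood_in_def using e(1) \<open>c > 0\<close>
    by (intro exI[of _ ?W]) (simp add: blinfun.zero_right)
  moreover have "?W \<inter> K \<subseteq> U"
  proof
    fix k assume k: "k \<in> ?W \<inter> K"
    then have "c * norm k < c * e"
      using f[of k] by auto
    then show "k \<in> U" using e(2) \<open>c > 0\<close> by (auto simp: subset_iff)
  qed
  ultimately show "\<exists>W. neighbourhood_in weak_topology 0 W \<and> W \<inter> K \<subseteq> U" by blast
qed (rule assms(1))

text \<open>The inequality c * norm z \<le> z f defines a closed set in the bidual and holds on the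
  embedded cone, since the embedding does not increase norms. If it holds for both \<open>z\<close>
  and \<open>- z\<close>, adding the two gives \<open>z = 0\<close>.\<close>

lemma norming_functional_imp_pointed_completion:
  fixes f :: "'a::real_normed_vector \<Rightarrow>\<^sub>L real"
  assumes "0 \<in> K" "c > 0" and f: "\<And>k. k \<in> K \<Longrightarrow> c * norm k \<le> blinfun_apply f k"
  shows "pointed (cone_completion K)"
proof -
  have *: "c * norm z \<le> blinfun_apply z f" if "z \<in> cone_completion K" for z
  proof -
    let ?S = "{z :: ('a \<Rightarrow>\<^sub>L real) \<Rightarrow>\<^sub>L real. c * norm z \<le> blinfun_apply z f}"
    have "closed ?S"
      by (intro closed_Collect_le continuous_intros)
    moreover have "bidual_embedding ` K \<subseteq> ?S"
    proof clarify
      fix k assume "k \<in> K"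
      have "c * norm (bidual_embedding k) \<le> c * norm k"
        using norm_bidual_embedding_le \<open>c > 0\<close> by (intro mult_left_mono) auto
      then show "c * norm (bidual_embedding k) \<le> blinfun_apply (bidual_embedding k) f"
        using f[OF \<open>k \<in> K\<close>] by (simp add: bidual_embedding.rep_eq)
    qed
    ultimately show ?thesis
      using that closure_minimal[of "bidual_embedding ` K" ?S] unfolding cone_completion_def by blast
  qed
  have "z = 0" if "z \<in> cone_completion K" "- z \<in> cone_completion K" for z
    using *[OF that(1)] *[OF that(2)] \<open>c > 0\<close> 
    by (smt (verit) blinfun.minus_left mult_pos_pos norm_minus_cancel zero_less_norm_iff)
  moreover have "0 \<in> cone_completion K"
    using \<open>0 \<in> K\<close> closure_subset[of "bidual_embedding ` K"] linear_0[OF linear_bidual_embedding]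
    unfolding cone_completion_def by (metis image_eqI subsetD)
  ultimately show ?thesis
    unfolding pointed_def by (auto intro: image_eqI[of _ _ 0])
qed

section \<open>Continuity and a pointed completion imply denting\<close>

lemma point_of_continuity_imp_norming_family:
  fixes K :: "'a::real_normed_vector set"
  assumes K: "convex_cone K" and pc: "0 \<in> points_of_continuity K"
  obtains G :: "('a \<Rightarrow>\<^sub>L real) set" and d :: real
  where "finite G" "d > 0"
    "\<And>k. k \<in> K \<Longrightarrow> k \<noteq> 0 \<Longrightarrow> \<exists>g\<in>G. d * norm k \<le> blinfun_apply g k"
proof -
  have "neighbourhood_in euclidean 0 (ball (0::'a) 1)"
    by (auto simp: neighbourhood_in_euclidean_0 intro: exI[of _ 1])
  then obtain W where "neighbourhood_in weak_topology 0 W" "W \<inter> K \<subseteq> ball 0 1"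
    using pc unfolding points_of_continuity_def by blast
  then obtain V :: "'a set" where V: "openin weak_topology V" "0 \<in> V" "V \<inter> K \<subseteq> ball 0 1"
    unfolding neighbourhood_in_def by blast
  obtain G :: "('a \<Rightarrow>\<^sub>L real) set" and d :: real
    where G: "finite G" "d > 0" "{x. \<forall>g\<in>G. \<bar>blinfun_apply g x\<bar> < d} \<subseteq> V"
    using weak_open_contains_slab[OF V(1,2)] .
  \<comment> \<open>Unit vectors of the cone lie outside the slab. Adding the negatives of the
    functionals removes the absolute value, so that the bounds of vectors normed by the same
    functional can be added.\<close>
  have "\<exists>g\<in>G \<union> uminus ` G. d * norm k \<le> blinfun_apply g k" if k: "k \<in> K" "k \<noteq> 0" for k
  proof -
    let ?k = "(1 / norm k) *\<^sub>R k"
    have "?k \<in> K" "norm ?k = 1"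
      using convex_coneD(3)[OF K k(1), of "1 / norm k"] k(2) by auto
    then have "?k \<notin> V" using V(3) by auto
    then obtain g where g: "g \<in> G" "d \<le> \<bar>blinfun_apply g ?k\<bar>"
      using G(3) by (force simp: not_less)
    then have "d * norm k \<le> \<bar>blinfun_apply g k\<bar>"
      using k(2) by (simp add: blinfun.scaleR_right field_simps abs_mult)
    then have "d * norm k \<le> blinfun_apply g k \<or> d * norm k \<le> blinfun_apply (- g) k"
      by (auto simp: blinfun.minus_left abs_if split: if_splits)
    then show ?thesis using g(1) by blast
  qed
  then show ?thesis using that[of "G \<union> uminus ` G" d] G by auto
qed

text \<open>If this failed there would be unit vectors \<open>u n\<close> and vectors \<open>v n\<close> in the cone with
  \<open>u n + v n\<close> tending to 0. Along a subsequence on which all functionals of the norming family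
  converge, the cone elements \<open>u l + v j\<close> become small, so \<open>u\<close> is Cauchy and its limit
  in the bidual lies in the completed cone together with its negative.\<close>

lemma pointed_completion_imp_normal:
  fixes K :: "'a::real_normed_vector set" and G :: "('a \<Rightarrow>\<^sub>L real) set"
  assumes K: "convex_cone K" and pt: "pointed (cone_completion K)"
    and G: "finite G" "d > 0"
      "\<And>k. k \<in> K \<Longrightarrow> k \<noteq> 0 \<Longrightarrow> \<exists>g\<in>G. d * norm k \<le> blinfun_apply g k"
  obtains M where "M > 0" "\<And>u v. u \<in> K \<Longrightarrow> v \<in> K \<Longrightarrow> norm u \<le> M * norm (u + v)"
proof -
  \<comment> \<open>A seminorm that is comparable with the norm on the cone, but depends only on
    finitely many functionals.\<close>
  define P where "P = (\<lambda>x. \<Sum>g\<in>G. \<bar>blinfun_apply g x\<bar>)"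
  define B where "B = (\<Sum>g\<in>G. norm g)"
  have P_le: "P x \<le> B * norm x" for x
    unfolding P_def B_def sum_distrib_right
    by (intro sum_mono) (simp flip: real_norm_def add: norm_blinfun)
  have P_add: "P (x + y) \<le> P x + P y" for x y
    unfolding P_def sum.distrib[symmetric]
    by (intro sum_mono) (simp add: blinfun.add_right abs_triangle_ineq)
  have P_ge: "d * norm k \<le> P k" if "k \<in> K" for k
  proof (cases "k = 0")
    case True
    then show ?thesis by (simp add: P_def blinfun.zero_right)
  next
    case False
    then obtain g where "g \<in> G" "d * norm k \<le> blinfun_apply g k" using G(3) \<open>k \<in> K\<close> by blast
    moreover have "\<bar>blinfun_apply g k\<bar> \<le> P k"
      unfolding P_def using \<open>g \<in> G\<close> G(1) by (intro member_le_sum) auto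
    ultimately show ?thesis by simp
  qed
  have "\<exists>M>0. \<forall>u\<in>K. \<forall>v\<in>K. norm u \<le> M * norm (u + v)"
  proof (rule ccontr)
    assume neg: "\<not> ?thesis"
    have "\<exists>u v. u \<in> K \<and> v \<in> K \<and> norm u = 1 \<and> norm (u + v) < 1 / real (Suc n)" for n
    proof -
      obtain u v where uv: "u \<in> K" "v \<in> K" "norm u > real (Suc n) * norm (u + v)"
        using neg by (metis not_less of_nat_0_less_iff zero_less_Suc)
      then have u: "norm u > 0"
        by (metis le_less_trans mult_nonneg_nonneg norm_ge_zero of_nat_0_le_iff)
      let ?a = "1 / norm u"
      have "norm (?a *\<^sub>R u + ?a *\<^sub>R v) = norm (u + v) / norm u"
        by (simp flip: scaleR_add_right)
      also have "\<dots> < 1 / real (Suc n)"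
        using uv(3) u by (simp add: field_simps del: of_nat_Suc)
      finally show ?thesis
        using uv u convex_coneD(3)[OF K, of _ ?a]
        by (intro exI[of _ "?a *\<^sub>R u"] exI[of _ "?a *\<^sub>R v"]) auto
    qed
    then obtain u' v' where u': "\<And>n. u' n \<in> K" "\<And>n. norm (u' n) = 1" and v': "\<And>n. v' n \<in> K"
      and s': "\<And>n. norm (u' n + v' n) < 1 / real (Suc n)"
      by metis
    have "bounded (range (\<lambda>n. g (u' n)))" if g: "g \<in> blinfun_apply ` G" for g
    proof -
      obtain h where "g = blinfun_apply h" using g by blast
      then show ?thesis
        using norm_blinfun[of h "u' _"] u'(2) by (intro boundedI[of _ "norm h"]) auto
    qed
    then obtain r :: "nat \<Rightarrow> nat" where r: "strict_mono r"
      "\<And>g. g \<in> blinfun_apply ` G \<Longrightarrow> convergent (\<lambda>n. g (u' (r n)))"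
      using convergent_subseq_finite_family[of "blinfun_apply ` G" u'] G(1) by blast
    define u v where "u = u' \<circ> r" and "v = v' \<circ> r"
    have u: "\<And>n. u n \<in> K" "\<And>n. norm (u n) = 1" and v: "\<And>n. v n \<in> K"
      using u' v' by (auto simp: u_def v_def)
    have "(\<lambda>n. norm (u' n + v' n)) \<longlonglongrightarrow> 0"
      by (rule tendsto_sandwich[OF _ _ tendsto_const LIMSEQ_inverse_real_of_nat])
        (use s' in \<open>auto simp: inverse_eq_divide simp del: of_nat_Suc
          intro!: always_eventually less_imp_le\<close>)
    then have s: "(\<lambda>n. norm (u n + v n)) \<longlonglongrightarrow> 0"
      using LIMSEQ_subseq_LIMSEQ[OF _ r(1)] by (fastforce simp: u_def v_def o_def)
    obtain L where L: "(\<lambda>n. blinfun_apply g (u n)) \<longlonglongrightarrow> L g" if "g \<in> G" for g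
      using r(2) unfolding convergent_def u_def o_def by (metis imageI)
    define D where "D = (\<lambda>n. \<Sum>g\<in>G. \<bar>blinfun_apply g (u n) - L g\<bar>)"
    have D: "D \<longlonglongrightarrow> 0"
    proof -
      have "(\<lambda>n. \<bar>blinfun_apply g (u n) - L g\<bar>) \<longlonglongrightarrow> 0" if "g \<in> G" for g
        using tendsto_rabs_zero[OF LIM_zero[OF L[OF that]]] .
      then show ?thesis unfolding D_def by (rule tendsto_null_sum)
    qed
    have diff: "P (u l - u j) \<le> D l + D j" for l j
      unfolding P_def D_def sum.distrib[symmetric] by (intro sum_mono) (simp add: blinfun.diff_right)
    \<comment> \<open>Collects the terms of the estimate below so that the bound on the distance
      splits into one summand per index.\<close>
    define h where "h = (\<lambda>n. D n / d + (B / d + 1) * norm (u n + v n))"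
    have h: "h \<longlonglongrightarrow> 0"
      unfolding h_def
      using tendsto_add[OF tendsto_divide[OF D tendsto_const[of d]] tendsto_mult[OF tendsto_const s]]
        G(2) by simp
    have dist_le: "dist (u l) (u j) \<le> h l + h j" for l j
    proof -
      \<comment> \<open>The difference \<open>u l - u j\<close> need not lie in the cone, but
        \<open>u l + v j\<close> does, so the lower bound for \<open>P\<close> applies to it;
        \<open>v j\<close> is close to \<open>- u j\<close>.\<close>
      have "d * norm (u l + v j) \<le> P ((u l - u j) + (u j + v j))"
        using P_ge[OF convex_coneD(2)[OF K u(1) v]] by simp
      also have "\<dots> \<le> D l + D j + B * norm (u j + v j)"
        using P_add[of "u l - u j" "u j + v j"] diff[of l j] P_le[of "u j + v j"] by linarith
      finally have "norm (u l + v j) \<le> (D l + D j + B * norm (u j + v j)) / d"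
        using G(2) by (simp add: pos_le_divide_eq mult.commute)
      then have 1: "norm (u l + v j) \<le> D l / d + D j / d + B / d * norm (u j + v j)"
        by (simp add: add_divide_distrib)
      have "norm (u l - u j) \<le> norm (u l + v j) + norm (u j + v j)"
        using norm_triangle_ineq4[of "u l + v j" "u j + v j"] by simp
      moreover have "0 \<le> (B / d + 1) * norm (u l + v l)"
        using G(2) by (intro mult_nonneg_nonneg add_nonneg_nonneg) (auto simp: B_def sum_nonneg)
      ultimately show ?thesis
        using 1 by (simp add: h_def dist_norm algebra_simps)
    qed
    have "Cauchy (\<lambda>n. bidual_embedding (u n))"
    proof (rule metric_CauchyI)
      fix e :: real assume "e > 0"
      then have "eventually (\<lambda>n. h n < e / 2) sequentially"
        using order_tendstoD(2)[OF h, of "e / 2"] by simp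
      then obtain N where N: "\<And>n. n \<ge> N \<Longrightarrow> h n < e / 2"
        by (auto simp: eventually_sequentially)
      have "dist (bidual_embedding (u m)) (bidual_embedding (u n)) < e" if "m \<ge> N" "n \<ge> N" for m n
        using dist_bidual_embedding_le[of "u m" "u n"] dist_le[of m n] N[OF that(1)] N[OF that(2)]
        by linarith
      then show "\<exists>N. \<forall>m\<ge>N. \<forall>n\<ge>N. dist (bidual_embedding (u m)) (bidual_embedding (u n)) < e" by blast
    qed
    then obtain z where z: "(\<lambda>n. bidual_embedding (u n)) \<longlonglongrightarrow> z"
      using Cauchy_convergent convergent_def by blast
    have "(\<lambda>n. bidual_embedding (u n + v n)) \<longlonglongrightarrow> 0"
      by (rule tendsto_norm_zero_cancel, rule tendsto_sandwich[OF _ _ tendsto_const s])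
        (simp_all add: norm_bidual_embedding_le)
    from tendsto_diff[OF this z] have w: "(\<lambda>n. bidual_embedding (v n)) \<longlonglongrightarrow> - z"
      by (simp add: linear_add[OF linear_bidual_embedding])
    have lim: "y \<in> cone_completion K"
      if "\<And>n. x n \<in> K" "(\<lambda>n. bidual_embedding (x n)) \<longlonglongrightarrow> y" for x y
      unfolding cone_completion_def closure_sequential
      using that by (intro exI[of _ "\<lambda>n. bidual_embedding (x n)"]) simp
    have "- z \<in> cone_completion K" "z \<in> cone_completion K"
      using lim[OF v w] lim[OF u(1) z] .
    then have "z = 0"
      using pt unfolding pointed_def by (metis IntI empty_iff image_eqI insert_iff minus_minus)
    \<comment> \<open>Since \<open>z = 0\<close>, every functional tends to 0 along
      \<open>u\<close>, and so does \<open>P\<close>; but \<open>P\<close> is at least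
      \<open>d\<close> on unit vectors of the cone.\<close>
    have "(\<lambda>n. \<bar>blinfun_apply g (u n)\<bar>) \<longlonglongrightarrow> 0" for g :: "'a \<Rightarrow>\<^sub>L real"
    proof -
      have "(\<lambda>n. blinfun_apply (bidual_embedding (u n)) g) \<longlonglongrightarrow> blinfun_apply z g"
        by (intro tendsto_intros z)
      then show ?thesis
        using tendsto_rabs_zero \<open>z = 0\<close> by (auto simp: bidual_embedding.rep_eq)
    qed
    then have "(\<lambda>n. P (u n)) \<longlonglongrightarrow> 0"
      unfolding P_def by (intro tendsto_null_sum)
    moreover have "d \<le> P (u n)" for n
      using P_ge[OF u(1), of n] u(2)[of n] by simp
    ultimately have "d \<le> 0"
      by (intro LIMSEQ_le_const) auto
    then show False using G(2) by simp
  qed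
  then show ?thesis using that by blast
qed

text \<open>Collecting the summands of a convex combination according to the functional of \<open>G\<close> that
  norms them bounds their number by \<open>card G\<close>, and normality bounds each of them by the sum.\<close>

lemma normal_norming_family_imp_denting:
  fixes K :: "'a::real_normed_vector set" and G :: "('a \<Rightarrow>\<^sub>L real) set"
  assumes K: "convex_cone K"
    and G: "finite G" "d > 0"
      "\<And>k. k \<in> K \<Longrightarrow> k \<noteq> 0 \<Longrightarrow> \<exists>g\<in>G. d * norm k \<le> blinfun_apply g k"
    and M: "M > 0" "\<And>u v. u \<in> K \<Longrightarrow> v \<in> K \<Longrightarrow> norm u \<le> M * norm (u + v)"
  shows "0 \<in> denting_points K"
  unfolding denting_points_def
proof (intro CollectI conjI allI impI)
  show "0 \<in> K" using convex_coneD(1)[OF K] .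
next
  fix U :: "'a set" assume "neighbourhood_in euclidean 0 U"
  then obtain e where e: "e > 0" "ball 0 e \<subseteq> U"
    by (auto simp: neighbourhood_in_euclidean_0)
  \<comment> \<open>Here \<open>y g\<close> stands for the sum of those terms of a convex
    combination that \<open>g\<close> norms. The conditions are preserved by convex combinations of
    families, so \<open>T\<close> is convex.\<close>
  define Q where "Q = (\<lambda>y. (\<forall>g\<in>G. y g \<in> K) \<and> d * e \<le> (\<Sum>g\<in>G. blinfun_apply g (y g)))"
  define T where "T = {(\<Sum>g\<in>G. y g) |y. Q y}"
  define B where "B = (\<Sum>g\<in>G. norm g)"
  have "K - U \<subseteq> T"
  proof
    fix k assume "k \<in> K - U"
    then have k: "k \<in> K" "e \<le> norm k" "k \<noteq> 0"
      using e by (auto simp: subset_iff not_less)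
    then obtain g where g: "g \<in> G" "d * norm k \<le> blinfun_apply g k" using G(3) by blast
    \<comment> \<open>A single vector is put in the slot of a functional that norms it.\<close>
    let ?y = "\<lambda>h. if h = g then k else 0"
    have "d * e \<le> blinfun_apply g k"
      using g(2) mult_left_mono[OF k(2), of d] G(2) by linarith
    also have "blinfun_apply g k = (\<Sum>h\<in>G. if h = g then blinfun_apply g k else 0)"
      using g(1) G(1) by simp
    also have "\<dots> = (\<Sum>h\<in>G. blinfun_apply h (?y h))"
      by (intro sum.cong) (auto simp: blinfun.zero_right)
    finally have "Q ?y"
      using k(1) convex_coneD(1)[OF K] by (simp add: Q_def)
    moreover have "(\<Sum>h\<in>G. ?y h) = k" using g(1) G(1) by simp
    ultimately show "k \<in> T" unfolding T_def by (intro CollectI exI[of _ ?y]) simp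
  qed
  moreover have "convex T"
  proof (rule convexI)
    fix x x' and a b :: real
    assume "x \<in> T" "x' \<in> T" and ab: "0 \<le> a" "0 \<le> b" "a + b = 1"
    then obtain y y' where y: "x = (\<Sum>g\<in>G. y g)" "Q y" and y': "x' = (\<Sum>g\<in>G. y' g)" "Q y'"
      by (auto simp: T_def)
    let ?y = "\<lambda>g. a *\<^sub>R y g + b *\<^sub>R y' g"
    have "a * (d * e) + b * (d * e) \<le>
      a * (\<Sum>g\<in>G. blinfun_apply g (y g)) + b * (\<Sum>g\<in>G. blinfun_apply g (y' g))"
      using y(2) y'(2) ab by (intro add_mono mult_left_mono) (auto simp: Q_def)
    then have "d * e \<le> (\<Sum>g\<in>G. blinfun_apply g (?y g))"
      using ab(3) by (simp add: blinfun.add_right blinfun.scaleR_right sum.distrib sum_distrib_left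
          flip: distrib_right)
    then have "Q ?y"
      using y(2) y'(2) ab convex_coneD(2,3)[OF K] by (simp add: Q_def)
    moreover have "a *\<^sub>R x + b *\<^sub>R x' = (\<Sum>g\<in>G. ?y g)"
      by (simp add: y(1) y'(1) scaleR_sum_right sum.distrib)
    ultimately show "a *\<^sub>R x + b *\<^sub>R x' \<in> T" unfolding T_def by (intro CollectI exI[of _ ?y]) simp
  qed
  ultimately have hull: "convex hull (K - U) \<subseteq> T" by (rule hull_minimal)
  have bound: "d * e \<le> B * M * norm x" if x: "x \<in> T" for x
  proof -
    obtain y where y: "x = (\<Sum>g\<in>G. y g)" "Q y"
      using x by (auto simp: T_def)
    have "norm (y g) \<le> M * norm x" if "g \<in> G" for g
    proof -
      \<comment> \<open>The sum over the other slots lies in the cone, so normality bounds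
        \<open>y g\<close> by the total.\<close>
      have "(\<Sum>h\<in>F. y h) \<in> K" if "finite F" "F \<subseteq> G" for F
        using that y(2) by induction (auto simp: Q_def intro: convex_coneD[OF K])
      then have "norm (y g) \<le> M * norm (y g + (\<Sum>h\<in>G - {g}. y h))"
        using y(2) G(1) that by (intro M(2)) (auto simp: Q_def)
      then show ?thesis
        using y(1) sum.remove[OF G(1) that, of y] by simp
    qed
    then have "blinfun_apply g (y g) \<le> norm g * (M * norm x)" if "g \<in> G" for g
      using that norm_blinfun[of g "y g"] mult_left_mono[of "norm (y g)" "M * norm x" "norm g"]
      by (smt (verit) norm_ge_zero real_norm_def)
    then have "(\<Sum>g\<in>G. blinfun_apply g (y g)) \<le> (\<Sum>g\<in>G. norm g * (M * norm x))"
      by (intro sum_mono)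
    then show ?thesis
      using y(2) by (simp add: Q_def B_def sum_distrib_right mult.assoc)
  qed
  show "0 \<notin> closure (convex hull (K - U))"
  proof
    assume "0 \<in> closure (convex hull (K - U))"
    moreover have "closed {x. d * e \<le> B * M * norm x}"
      by (intro closed_Collect_le continuous_intros)
    moreover have "convex hull (K - U) \<subseteq> {x. d * e \<le> B * M * norm x}"
      using hull bound by auto
    ultimately have "0 \<in> {x :: 'a. d * e \<le> B * M * norm x}"
      using closure_minimal by (metis subsetD)
    then show False using e(1) G(2) by (simp add: mult_le_0_iff)
  qed
qed

theorem theorem4p1:
  fixes K :: "'a::real_normed_vector set"
  assumes "convex_cone K" and "pointed K"
  shows "0 \<in> denting_points K \<longleftrightarrow>
    0 \<in> points_of_continuity K \<and> pointed (cone_completion K)"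
proof
  assume "0 \<in> denting_points K"
  then obtain f :: "'a \<Rightarrow>\<^sub>L real" and c :: real
    where "c > 0" "\<And>k. k \<in> K \<Longrightarrow> c * norm k \<le> blinfun_apply f k"
    using denting_imp_norming_functional[OF assms(1)] by blast
  then show "0 \<in> points_of_continuity K \<and> pointed (cone_completion K)"
    using norming_functional_imp_point_of_continuity norming_functional_imp_pointed_completion
      convex_coneD(1)[OF assms(1)] by blast
next
  assume *: "0 \<in> points_of_continuity K \<and> pointed (cone_completion K)"
  then obtain G :: "('a \<Rightarrow>\<^sub>L real) set" and d :: real where G: "finite G" "d > 0"
    "\<And>k. k \<in> K \<Longrightarrow> k \<noteq> 0 \<Longrightarrow> \<exists>g\<in>G. d * norm k \<le> blinfun_apply g k"
    using point_of_continuity_imp_norming_family[OF assms(1)] by blast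
  obtain M where "M > 0" "\<And>u v. u \<in> K \<Longrightarrow> v \<in> K \<Longrightarrow> norm u \<le> M * norm (u + v)"
    using pointed_completion_imp_normal[OF assms(1) conjunct2[OF *] G] by blast
  then show "0 \<in> denting_points K"
    using normal_norming_family_imp_denting[OF assms(1) G] by blast
qed

end
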